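(* For all integers $n\geq0$, we have \[ \mathcal{EO}_u(2n)=\sum_{k=0}^{\left\lfloor\frac{\sqrt{1+8n}-1}{2}\right\rfloor }p\left(n-\frac{k(k+1)}{2}\right). \]
   Context: For a positive integer $k$, let $f_k:=(q^k;q^k)_\infty=\prod_{i=1}^\infty(1-q^{ki})$. The integers $\mathcal{EO}_u(n)$, $n\ge 0$, are defined by $\sum_{n=0}^\infty \mathcal{EO}_u(n)q^n=\dfrac{f_4^2}{f_2^2}$. Here $p(n)$ denotes the number of partitions of the nonnegative integer $n$, with $p(0)=1$, so that $\sum_{n=0}^\infty p(n)q^n=1/f_1$. *)

theory Defs
  imports "HOL-Analysis.Analysis" "HOL-Library.Multiset"
begin

text \<open>
  All $q$-series are formal power series over the reals, \<^const>\<open>fps_X\<close> being $q$. The infinite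
  product is the library's product \<^const>\<open>prodinf\<close> with respect to the metric of formal power
  series; as it is indexed from $0$, the factor of index $i$ is $1 - q^{k(i+1)}$.
\<close>

definition euler_fps :: "nat \<Rightarrow> real fps" where
  "euler_fps k = (\<Prod>i. 1 - fps_X ^ (k * (i + 1)))"

lemma euler_fps_has_prod:
  assumes "k > 0"
  shows "(\<lambda>i. 1 - fps_X ^ (k * (i + 1))) has_prod euler_fps k"
    and "(\<lambda>n. \<Prod>i\<le>n. 1 - fps_X ^ (k * (i + 1))) \<longlonglongrightarrow> euler_fps k"
    and "fps_nth (euler_fps k) 0 = 1"
proof -
  let ?f = "\<lambda>i. 1 - fps_X ^ (k * (i + 1)) :: real fps"
  have f0: "fps_nth (?f i) 0 = 1" for i
    using assms by simp
  have nz: "?f i \<noteq> 0" for i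
    using f0[of i] by (metis fps_zero_nth zero_neq_one)
  have sd: "subdegree (?f i - 1) > n" if "i > n" for i n
  proof -
    have "?f i - 1 = - (fps_X ^ (k * (i + 1)))"
      by simp
    hence "subdegree (?f i - 1) = k * (i + 1)"
      by (simp only: subdegree_uminus fps_X_power_subdegree)
    moreover have "i + 1 \<le> k * (i + 1)"
      using assms by (cases k) auto
    ultimately show ?thesis using that by linarith
  qed
  obtain P where P: "(\<lambda>n. \<Prod>i\<le>n. ?f i) \<longlonglongrightarrow> P"
    using tendsto_prod_fps[of ?f "\<lambda>n. n"] nz sd by blast
  have "eventually (\<lambda>n. fps_nth (\<Prod>i\<le>n. ?f i) 0 = fps_nth P 0) sequentially"
    using P unfolding tendsto_fps_iff by blast
  then obtain n where "fps_nth (\<Prod>i\<le>n. ?f i) 0 = fps_nth P 0"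
    by (auto simp: eventually_sequentially)
  moreover have "fps_nth (\<Prod>i\<le>n. ?f i) 0 = 1"
  proof (induction n)
    case (Suc n)
    then show ?case
      using f0[of "Suc n"] by (simp only: prod.atMost_Suc fps_mult_nth_0 mult_1_left)
  qed (use f0[of 0] in simp)
  ultimately have P0: "fps_nth P 0 = 1" by simp
  hence "P \<noteq> 0" by auto
  with P have hp: "?f has_prod P"
    unfolding has_prod_def raw_has_prod_def by simp
  hence eq: "euler_fps k = P"
    unfolding euler_fps_def by (rule has_prod_unique[symmetric])
  show "?f has_prod euler_fps k" "(\<lambda>n. \<Prod>i\<le>n. ?f i) \<longlonglongrightarrow> euler_fps k"
       "fps_nth (euler_fps k) 0 = 1"
    using hp P P0 by (simp_all only: eq)
qed

lemma fps_mult_Ints: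
  fixes F G :: "real fps"
  assumes "\<And>n. fps_nth F n \<in> \<int>" "\<And>n. fps_nth G n \<in> \<int>"
  shows "fps_nth (F * G) n \<in> \<int>"
  unfolding fps_mult_nth by (intro Ints_sum Ints_mult assms)

lemma fps_inverse_Ints:
  fixes F :: "real fps"
  assumes "\<And>n. fps_nth F n \<in> \<int>" "fps_nth F 0 = 1"
  shows "fps_nth (inverse F) n \<in> \<int>"
proof (induction n rule: less_induct)
  case (less n)
  show ?case
  proof (cases n)
    case 0
    then show ?thesis using assms by simp
  next
    case (Suc m)
    have "fps_nth (inverse F) n = - (\<Sum>i=1..n. fps_nth F i * fps_nth (inverse F) (n - i))"
      using assms(2) by (simp add: Suc fps_inverse_def)
    also have "\<dots> \<in> \<int>"
      by (intro Ints_minus Ints_sum Ints_mult assms(1) less.IH) auto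
    finally show ?thesis .
  qed
qed

lemma euler_fps_Ints:
  assumes "k > 0"
  shows "fps_nth (euler_fps k) m \<in> \<int>"
proof -
  let ?f = "\<lambda>i. 1 - fps_X ^ (k * (i + 1)) :: real fps"
  have "eventually (\<lambda>n. fps_nth (\<Prod>i\<le>n. ?f i) m = fps_nth (euler_fps k) m) sequentially"
    using euler_fps_has_prod(2)[OF assms] unfolding tendsto_fps_iff by blast
  then obtain n where n: "fps_nth (\<Prod>i\<le>n. ?f i) m = fps_nth (euler_fps k) m"
    by (auto simp: eventually_sequentially)
  have "fps_nth (\<Prod>i\<le>n. ?f i) m \<in> \<int>" for m
  proof (induction n arbitrary: m)
    case 0
    show ?case by simp
  next
    case (Suc n)
    show ?case
      unfolding prod.atMost_Suc by (rule fps_mult_Ints[OF Suc]) simp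
  qed
  with n show ?thesis by metis
qed

text \<open>
  The quotient is formed over a field, where formal power series have division; the lemma
  \<open>of_int_EO_u\<close> shows that its coefficients are integers, so that \<open>EO_u n\<close> is well defined.
\<close>

definition EO_u :: "nat \<Rightarrow> int" where
  "EO_u n = (THE z. of_int z = fps_nth ((euler_fps 4)\<^sup>2 / (euler_fps 2)\<^sup>2) n)"

lemma of_int_EO_u: "of_int (EO_u n) = fps_nth ((euler_fps 4)\<^sup>2 / (euler_fps 2)\<^sup>2) n"
proof -
  have g0: "fps_nth ((euler_fps 2)\<^sup>2) 0 = 1"
    by (simp add: power2_eq_square euler_fps_has_prod(3))
  have "(euler_fps 4)\<^sup>2 / (euler_fps 2)\<^sup>2 = (euler_fps 4)\<^sup>2 * inverse ((euler_fps 2)\<^sup>2)"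
    using g0 by (intro fps_divide_unit) simp
  moreover have "fps_nth ((euler_fps 4)\<^sup>2 * inverse ((euler_fps 2)\<^sup>2)) n \<in> \<int>"
    by (intro fps_mult_Ints fps_inverse_Ints g0)
       (auto simp: power2_eq_square intro!: fps_mult_Ints euler_fps_Ints)
  ultimately obtain z where z: "fps_nth ((euler_fps 4)\<^sup>2 / (euler_fps 2)\<^sup>2) n = of_int z"
    by (metis Ints_cases)
  show ?thesis
    unfolding EO_u_def z by simp
qed

lemma EO_u_gf: "Abs_fps (\<lambda>n. of_int (EO_u n)) = (euler_fps 4)\<^sup>2 / (euler_fps 2)\<^sup>2"
  by (simp add: fps_eq_iff of_int_EO_u)

text \<open>A partition of \<open>n\<close> is a multiset of positive integers, its parts, with sum \<open>n\<close>.\<close>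

definition partition_number :: "nat \<Rightarrow> nat" where
  "partition_number n = card {M :: nat multiset. 0 \<notin># M \<and> sum_mset M = n}"

lemma finite_partitions: "finite {M :: nat multiset. 0 \<notin># M \<and> sum_mset M = n}"
proof -
  have "size M \<le> sum_mset M \<and> set_mset M \<subseteq> {..sum_mset M}"
    if "0 \<notin># M" for M :: "nat multiset"
    using that by (induction M) (auto simp: Suc_le_eq)
  hence "{M :: nat multiset. 0 \<notin># M \<and> sum_mset M = n} \<subseteq>
           (\<Union>m\<le>n. multisets_of_size {..n} m)"
    by (fastforce simp: multisets_of_size_def)
  thus ?thesis
    by (rule finite_subset) (auto intro: finite_multisets_of_size)
qed

lemma partition_number_0: "partition_number 0 = 1"
proof -
  have "{M :: nat multiset. 0 \<notin># M \<and> sum_mset M = 0} = {{#}}"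
    by (auto simp: sum_mset_0_iff) (metis multiset_nonemptyE)
  thus ?thesis by (simp add: partition_number_def)
qed

end

theory Submission
  imports Defs
begin

text \<open>
  Replacing $q^2$ by $q$, the even-indexed coefficients have generating function $f_2^2/f_1^2$, the
  product of $1/f_1 = \sum p(n) q^n$ and Gauss's $f_2^2/f_1 = \sum_k q^{k(k+1)/2}$. Gauss's identity is
  the limit of Shanks' finite form: with $P_n = \prod_{k=1}^{n} (1-q^{2k})/(1-q^{2k-1})$,
  $$\sum_{k=0}^{2n-1} q^{k(k+1)/2} = \sum_{s=0}^{n-1} \frac{P_n}{P_s} q^{s(2n+1)},$$
  where only the term $s=0$ survives as $n \to \infty$. The finite form is proved by induction on $n$,
  the difference of consecutive right-hand sides being a telescoping sum.
\<close>

section \<open>Shanks' finite identity\<close>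

text \<open>Here $R\,s\,n = P_n/P_s$, and $u_k$ is the inverse of $1-q^{2k+1}$.\<close>

lemma shanks_partial_sum:
  fixes q :: "'a :: comm_ring_1" and u :: "nat \<Rightarrow> 'a"
  defines "R \<equiv> \<lambda>s n. \<Prod>k\<in>{s..<n}. (1 - q ^ (2 * k + 2)) * u k"
  assumes u: "\<And>k. u k * (1 - q ^ (2 * k + 1)) = 1"
  assumes "m \<le> n"
  shows "(\<Sum>s\<le>m. R s (Suc n) * q ^ (s * (2 * n + 3)) - R s n * q ^ (s * (2 * n + 1))) =
           u n * (1 - q ^ (2 * m + 1)) * q ^ ((m + 1) * (2 * n + 1)) * R m n"
proof -
  \<comment> \<open>Inserting \<open>u n * (1 - q ^ (2 * n + 1)) = 1\<close> into the subtracted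
    term gives both terms the common factor
    \<open>u n * R s n * q ^ (s * (2 * n + 1))\<close>.\<close>
  have diff: "R s (Suc n) * q ^ (s * (2 * n + 3)) - R s n * q ^ (s * (2 * n + 1)) =
           u n * R s n * q ^ (s * (2 * n + 1)) *
             ((1 - q ^ (2 * n + 2)) * q ^ (2 * s) - (1 - q ^ (2 * n + 1)))"
    if "s \<le> n" for s
  proof -
    have "R s (Suc n) = R s n * ((1 - q ^ (2 * n + 2)) * u n)"
      using that by (simp add: R_def)
    moreover have "q ^ (s * (2 * n + 3)) = q ^ (s * (2 * n + 1)) * q ^ (2 * s)"
      by (simp add: algebra_simps flip: power_add)
    moreover have "R s n * q ^ (s * (2 * n + 1)) =
        u n * R s n * q ^ (s * (2 * n + 1)) * (1 - q ^ (2 * n + 1))"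
    proof -
      have "u n * R s n * q ^ (s * (2 * n + 1)) * (1 - q ^ (2 * n + 1)) =
          (u n * (1 - q ^ (2 * n + 1))) * (R s n * q ^ (s * (2 * n + 1)))"
        by (simp only: mult_ac)
      thus ?thesis by (simp only: u mult_1_left)
    qed
    ultimately show ?thesis by (simp only: right_diff_distrib) (simp only: mult_ac)
  qed
  show ?thesis
    using \<open>m \<le> n\<close>
  \<comment> \<open>With \<open>n\<close> fixed, the right-hand side is an antidifference in
    \<open>m\<close> of the summand. At \<open>m = n\<close> it collapses to
    \<open>q ^ ((n + 1) * (2 * n + 1))\<close>, since \<open>u n\<close> meets its inverse and
    \<open>R n n\<close> is an empty product.\<close>
  proof (induction m)
    case 0
    have "q ^ (2 * n + 2) = q * q ^ (2 * n + 1)"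
      by simp
    hence "u n * R 0 n * ((1 - q ^ (2 * n + 2)) - (1 - q ^ (2 * n + 1))) =
        u n * (1 - q) * q ^ (2 * n + 1) * R 0 n"
      by (simp add: algebra_simps)
    thus ?case
      using diff[of 0] by simp
  next
    case (Suc m)
    \<comment> \<open>Trading \<open>R m n\<close> for \<open>R (Suc m) n\<close> releases a factor
      \<open>u m\<close>, which cancels \<open>1 - q ^ (2 * m + 1)\<close> in the induction
      hypothesis.\<close>
    have "R m n = (1 - q ^ (2 * m + 2)) * u m * R (Suc m) n"
      using Suc.prems by (simp add: R_def prod.atLeast_Suc_lessThan)
    moreover have "(\<Sum>s\<le>m. R s (Suc n) * q ^ (s * (2 * n + 3)) - R s n * q ^ (s * (2 * n + 1))) =
           u n * (1 - q ^ (2 * m + 1)) * q ^ (Suc m * (2 * n + 1)) * R m n"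
      using Suc.IH[OF Suc_leD[OF Suc.prems]] unfolding Suc_eq_plus1 .
    ultimately have IH: "(\<Sum>s\<le>m. R s (Suc n) * q ^ (s * (2 * n + 3)) - R s n * q ^ (s * (2 * n + 1))) =
           u n * (u m * (1 - q ^ (2 * m + 1))) * q ^ (Suc m * (2 * n + 1)) * (1 - q ^ (2 * m + 2)) * R (Suc m) n"
      by (simp only: mult_ac)
    define a where "a = q ^ (Suc m * (2 * n + 1))"
    define b where "b = q ^ (2 * n + 1)"
    define c where "c = q ^ (2 * m + 2)"
    have e1: "q ^ ((Suc m + 1) * (2 * n + 1)) = a * b"
      unfolding a_def b_def power_add[symmetric] by (rule arg_cong[of _ _ "(^) q"]) simp
    have e2: "q ^ (2 * n + 2) = q * b" "q ^ (2 * Suc m) = c" "q ^ (2 * Suc m + 1) = q * c"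
      unfolding b_def c_def by simp_all
    have d: "R (Suc m) (Suc n) * q ^ (Suc m * (2 * n + 3)) - R (Suc m) n * a =
        u n * R (Suc m) n * a * ((1 - q * b) * c - (1 - b))"
      using diff[OF Suc.prems] unfolding e2 a_def[symmetric] b_def[symmetric] .
    \<comment> \<open>After the common factors are removed, this is (1 - c) + (1 - qb)c - (1 - b) =
      b(1 - qc).\<close>
    have "u n * 1 * a * (1 - c) * r + u n * r * a * ((1 - q * b) * c - (1 - b)) =
        u n * (1 - q * c) * (a * b) * r" for r
      by (simp add: algebra_simps)
    thus ?case
      unfolding sum.atMost_Suc IH d u e1 e2 a_def[symmetric] c_def[symmetric] .
  qed
qed

lemma shanks_identity:
  fixes q :: "'a :: comm_ring_1" and u :: "nat \<Rightarrow> 'a"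
  assumes u: "\<And>k. u k * (1 - q ^ (2 * k + 1)) = 1"
  shows "(\<Sum>k<2*n. q ^ (k * (k + 1) div 2)) =
           (\<Sum>s<n. (\<Prod>k\<in>{s..<n}. (1 - q ^ (2 * k + 2)) * u k) * q ^ (s * (2 * n + 1)))"
proof (induction n)
  case 0
  show ?case by simp
next
  case (Suc n)
  define R where "R = (\<lambda>s n. \<Prod>k\<in>{s..<n}. (1 - q ^ (2 * k + 2)) * u k)"
  have "R n n = 1"
    by (simp add: R_def)
  have e: "2 * n * (2 * n + 1) = 2 * (n * (2 * n + 1))"
      "Suc (2 * n) * (Suc (2 * n) + 1) = 2 * ((n + 1) * (2 * n + 1))"
    by (simp_all add: algebra_simps)
  have T: "2 * n * (2 * n + 1) div 2 = n * (2 * n + 1)"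
      "Suc (2 * n) * (Suc (2 * n) + 1) div 2 = (n + 1) * (2 * n + 1)"
    unfolding e by (rule nonzero_mult_div_cancel_left, simp)+
  have "(\<Sum>s\<le>n. R s (Suc n) * q ^ (s * (2 * n + 3))) - (\<Sum>s\<le>n. R s n * q ^ (s * (2 * n + 1)))
      = (u n * (1 - q ^ (2 * n + 1))) * q ^ ((n + 1) * (2 * n + 1)) * R n n"
    using shanks_partial_sum[OF u order_refl, of n] unfolding R_def sum_subtractf .
  \<comment> \<open>The range s \<le> n has one term more than the induction hypothesis, namely
    \<open>q ^ (n * (2 * n + 1))\<close>. This and the telescoped difference supply exactly the two
    new triangular powers, those for k = 2n and k = 2n + 1.\<close>
  hence "(\<Sum>s\<le>n. R s (Suc n) * q ^ (s * (2 * n + 3))) =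
      (\<Sum>s<n. R s n * q ^ (s * (2 * n + 1))) + q ^ (n * (2 * n + 1)) + q ^ ((n + 1) * (2 * n + 1))"
    unfolding u \<open>R n n = 1\<close> lessThan_Suc_atMost[symmetric] sum.lessThan_Suc
    by (simp only: mult_1_left mult_1_right diff_eq_eq add_ac)
  also have "\<dots> = (\<Sum>k<2*n. q ^ (k * (k + 1) div 2)) + q ^ (n * (2 * n + 1)) + q ^ ((n + 1) * (2 * n + 1))"
    unfolding Suc R_def ..
  also have "\<dots> = (\<Sum>k<2 * Suc n. q ^ (k * (k + 1) div 2))"
  proof -
    have "2 * Suc n = Suc (Suc (2 * n))" by simp
    thus ?thesis by (simp only: sum.lessThan_Suc T)
  qed
  finally have "(\<Sum>s\<le>n. R s (Suc n) * q ^ (s * (2 * n + 3))) = (\<Sum>k<2 * Suc n. q ^ (k * (k + 1) div 2))" .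
  moreover have "2 * Suc n + 1 = 2 * n + 3"
    by simp
  ultimately show ?case
    unfolding R_def lessThan_Suc_atMost by (simp only:)
qed

section \<open>Coefficientwise limits and substitution of a power of q\<close>

text \<open>Coefficient n of a product involves only the coefficients up to n of the factors, and
  these finitely many are eventually constant. The same argument serves for composition with a fixed
  inner series.\<close>

lemma tendsto_fps_mult:
  fixes f g :: "'b \<Rightarrow> 'a :: ring_1 fps"
  assumes "(f \<longlongrightarrow> F) L" "(g \<longlongrightarrow> G) L"
  shows "((\<lambda>x. f x * g x) \<longlongrightarrow> F * G) L"
  unfolding tendsto_fps_iff
proof
  fix n
  have "\<forall>\<^sub>F x in L. \<forall>i\<in>{0..n}. fps_nth (f x) i = fps_nth F i \<and> fps_nth (g x) i = fps_nth G i"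
    using assms unfolding tendsto_fps_iff
    by (intro eventually_ball_finite ballI eventually_conj) auto
  thus "\<forall>\<^sub>F x in L. fps_nth (f x * g x) n = fps_nth (F * G) n"
    by eventually_elim (simp add: fps_mult_nth)
qed

lemma tendsto_fps_compose:
  fixes f :: "'b \<Rightarrow> 'a :: ring_1 fps"
  assumes "(f \<longlongrightarrow> F) L"
  shows "((\<lambda>x. f x oo g) \<longlongrightarrow> (F oo g)) L"
  unfolding tendsto_fps_iff
proof
  fix n
  have "\<forall>\<^sub>F x in L. \<forall>i\<in>{0..n}. fps_nth (f x) i = fps_nth F i"
    using assms unfolding tendsto_fps_iff
    by (intro eventually_ball_finite ballI) auto
  thus "\<forall>\<^sub>F x in L. fps_nth (f x oo g) n = fps_nth (F oo g) n"
    by eventually_elim (simp add: fps_compose_nth)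
qed

text \<open>With l = 2 this extracts the even-indexed coefficients.\<close>

lemma fps_compose_X_power_nth:
  fixes F :: "'a :: comm_ring_1 fps"
  assumes "l > 0"
  shows "fps_nth (F oo fps_X ^ l) (l * n) = fps_nth F n"
proof -
  have "fps_nth (F oo fps_X ^ l) (l * n) = (\<Sum>i=0..l*n. if i = n then fps_nth F i else 0)"
    unfolding fps_compose_nth power_mult[symmetric] fps_X_power_nth
    using assms by (intro sum.cong) auto
  thus ?thesis using assms by simp
qed

lemma euler_fps_LIMSEQ:
  assumes "k > 0"
  shows "(\<lambda>n. \<Prod>i<n. 1 - fps_X ^ (k * (i + 1))) \<longlonglongrightarrow> euler_fps k"
proof -
  have "(\<lambda>n. \<Prod>i<Suc n. 1 - fps_X ^ (k * (i + 1))) \<longlonglongrightarrow> euler_fps k"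
    using euler_fps_has_prod(2)[OF assms] by (simp only: lessThan_Suc_atMost)
  thus ?thesis
    by (rule LIMSEQ_imp_Suc)
qed

text \<open>Substitution acts factor by factor on the finite products; both sides are then limits of
  the same sequence.\<close>

lemma euler_fps_compose:
  assumes "k > 0" "l > 0"
  shows "euler_fps k oo fps_X ^ l = euler_fps (l * k)"
proof (rule LIMSEQ_unique)
  have "(\<Prod>i<n. 1 - fps_X ^ (k * (i + 1))) oo fps_X ^ l =
          (\<Prod>i<n. 1 - fps_X ^ (l * k * (i + 1)) :: real fps)" for n
    using assms
    by (subst fps_compose_prod_distrib)
       (auto simp: fps_compose_sub_distrib fps_compose_power[symmetric] mult.assoc simp flip: power_mult
         simp del: add_mult_distrib2 mult_Suc_right)
  thus "(\<lambda>n. \<Prod>i<n. 1 - fps_X ^ (l * k * (i + 1))) \<longlonglongrightarrow> (euler_fps k oo fps_X ^ l)"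
    using tendsto_fps_compose[OF euler_fps_LIMSEQ[OF assms(1)], of "fps_X ^ l"] by simp
  show "(\<lambda>n. \<Prod>i<n. 1 - fps_X ^ (l * k * (i + 1))) \<longlonglongrightarrow> euler_fps (l * k)"
    using assms by (intro euler_fps_LIMSEQ) simp
qed

section \<open>Partitions and the inverse of f_1\<close>

text \<open>Bounding the parts by m matches the first m factors of f_1, so the generating function
  follows from an induction on m and a limit.\<close>

definition bounded_partitions :: "nat \<Rightarrow> nat \<Rightarrow> nat multiset set" where
  "bounded_partitions m n = {M. set_mset M \<subseteq> {1..m} \<and> sum_mset M = n}"

lemma finite_bounded_partitions: "finite (bounded_partitions m n)"
  by (rule finite_subset[OF _ finite_partitions[of n]]) (auto simp: bounded_partitions_def)

lemma bounded_partitions_eq: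
  assumes "n \<le> m"
  shows "bounded_partitions m n = {M. 0 \<notin># M \<and> sum_mset M = n}"
proof -
  have "x \<in> {1..m}" if "0 \<notin># M" "sum_mset M = n" "x \<in># M" for M x
    using sum_mset.remove[OF that(3)] that assms by (cases x) auto
  thus ?thesis
    unfolding bounded_partitions_def by auto
qed

text \<open>Partitions are split by whether \<open>Suc m\<close> occurs as a part; if it does,
  deleting one copy is a bijection. The case distinction guards against truncated
  subtraction.\<close>

lemma card_bounded_partitions_Suc:
  "card (bounded_partitions (Suc m) n) = card (bounded_partitions m n) +
     (if n < Suc m then 0 else card (bounded_partitions (Suc m) (n - Suc m)))"
proof -
  let ?A = "{M \<in> bounded_partitions (Suc m) n. Suc m \<in># M}"
  have "bounded_partitions (Suc m) n = bounded_partitions m n \<union> ?A"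
    unfolding bounded_partitions_def by (auto simp: subset_iff le_Suc_eq)
  moreover have "bounded_partitions m n \<inter> ?A = {}"
    unfolding bounded_partitions_def by (auto simp: subset_iff)
  ultimately have "card (bounded_partitions (Suc m) n) = card (bounded_partitions m n) + card ?A"
    using finite_bounded_partitions by (metis (no_types, lifting) card_Un_disjoint finite_Un)
  moreover have "?A = {}" if "n < Suc m"
    using that unfolding bounded_partitions_def by (auto dest!: multi_member_split)
  moreover have "?A = add_mset (Suc m) ` bounded_partitions (Suc m) (n - Suc m)" if "\<not> n < Suc m"
  proof (intro equalityI subsetI)
    fix M assume "M \<in> ?A"
    then obtain N where "M = add_mset (Suc m) N" "M \<in> bounded_partitions (Suc m) n"
      by (auto dest: multi_member_split)
    thus "M \<in> add_mset (Suc m) ` bounded_partitions (Suc m) (n - Suc m)"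
      by (auto simp: bounded_partitions_def)
  qed (use that in \<open>auto simp: bounded_partitions_def\<close>)
  moreover have "card (add_mset (Suc m) ` bounded_partitions (Suc m) (n - Suc m)) =
      card (bounded_partitions (Suc m) (n - Suc m))"
    by (intro card_image inj_onI) simp
  ultimately show ?thesis by (cases "n < Suc m") simp_all
qed

text \<open>By the recurrence, multiplying by \<open>1 - fps_X ^ (m + 1)\<close> lowers the bound
  from \<open>Suc m\<close> to \<open>m\<close>; at bound 0 only the empty partition is
  left.\<close>

lemma bounded_partitions_gf:
  "Abs_fps (\<lambda>n. real (card (bounded_partitions m n))) * (\<Prod>i<m. 1 - fps_X ^ (i + 1)) = 1"
proof (induction m)
  case 0
  have "bounded_partitions 0 n = (if n = 0 then {{#}} else {})" for n
    by (auto simp: bounded_partitions_def)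
  thus ?case by (auto simp: fps_eq_iff)
next
  case (Suc m)
  have step: "Abs_fps (\<lambda>n. real (card (bounded_partitions (Suc m) n))) * (1 - fps_X ^ (m + 1)) =
          Abs_fps (\<lambda>n. real (card (bounded_partitions m n)))"
    by (rule fps_ext)
       (simp add: right_diff_distrib fps_X_power_mult_right_nth card_bounded_partitions_Suc del: power_Suc)
  have "Abs_fps (\<lambda>n. real (card (bounded_partitions (Suc m) n))) * (\<Prod>i<Suc m. 1 - fps_X ^ (i + 1)) =
      Abs_fps (\<lambda>n. real (card (bounded_partitions (Suc m) n))) * (1 - fps_X ^ (m + 1)) *
        (\<Prod>i<m. 1 - fps_X ^ (i + 1))"
    by (simp only: prod.lessThan_Suc mult_ac)
  thus ?case
    unfolding step Suc .
qed

lemma bounded_partitions_gf_LIMSEQ: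
  "(\<lambda>m. Abs_fps (\<lambda>n. real (card (bounded_partitions m n))))
     \<longlonglongrightarrow> Abs_fps (\<lambda>n. real (partition_number n))"
  unfolding tendsto_fps_iff
proof
  fix n
  show "\<forall>\<^sub>F m in sequentially. fps_nth (Abs_fps (\<lambda>n. real (card (bounded_partitions m n)))) n =
      fps_nth (Abs_fps (\<lambda>n. real (partition_number n))) n"
    using eventually_ge_at_top[of n]
    by eventually_elim (simp add: bounded_partitions_eq partition_number_def)
qed

lemma partition_number_gf: "Abs_fps (\<lambda>n. real (partition_number n)) * euler_fps 1 = 1"
proof (rule LIMSEQ_unique)
  show "(\<lambda>m. 1) \<longlonglongrightarrow> (1 :: real fps)" by simp
  show "(\<lambda>m. 1) \<longlonglongrightarrow> Abs_fps (\<lambda>n. real (partition_number n)) * euler_fps 1"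
    using tendsto_fps_mult[OF bounded_partitions_gf_LIMSEQ euler_fps_LIMSEQ[OF zero_less_one]]
    unfolding mult_1_left bounded_partitions_gf .
qed

section \<open>Gauss's identity as a limit\<close>

lemma gauss_triangular_LIMSEQ:
  "(\<lambda>n. \<Sum>k<2*n. fps_X ^ (k * (k + 1) div 2))
     \<longlonglongrightarrow> (euler_fps 2)\<^sup>2 * Abs_fps (\<lambda>n. real (partition_number n))"
proof -
  define u :: "nat \<Rightarrow> real fps" where "u k = inverse (1 - fps_X ^ (2 * k + 1))" for k
  define R where "R s n = (\<Prod>k\<in>{s..<n}. (1 - fps_X ^ (2 * k + 2)) * u k)" for s n
  define A :: "nat \<Rightarrow> real fps" where "A n = (\<Prod>k<n. 1 - fps_X ^ (2 * (k + 1)))" for n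
  \<comment> \<open>\<open>P m\<close> inverts the product of the first m factors of f_1; the
    quotient P_n of the finite identity is \<open>R 0 n\<close>.\<close>
  define P where "P m = Abs_fps (\<lambda>n. real (card (bounded_partitions m n)))" for m
  have u: "u k * (1 - fps_X ^ (2 * k + 1)) = 1" for k
    unfolding u_def by (rule inverse_mult_eq_1) simp
  \<comment> \<open>Multiplying numerator and denominator of \<open>R 0 n\<close> by the even
    factors squares the numerator and completes the denominator to the first 2n factors of
    f_1.\<close>
  have R0: "R 0 n = A n * A n * P (2 * n)" for n
  proof -
    have RA: "R 0 n * (\<Prod>i<2*n. 1 - fps_X ^ (i + 1)) = A n * A n"
    proof (induction n)
      case (Suc n)
      have "(1 - fps_X ^ (2 * n + 2)) * u n * ((1 - fps_X ^ (2 * n + 1)) * (1 - fps_X ^ (2 * n + 2))) =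
        (1 - fps_X ^ (2 * n + 2)) * (1 - fps_X ^ (2 * n + 2)) * (u n * (1 - fps_X ^ (2 * n + 1)))"
        by (simp only: mult_ac)
      also have "\<dots> = (1 - fps_X ^ (2 * n + 2)) * (1 - fps_X ^ (2 * n + 2))"
        by (simp only: u mult_1_right)
      finally have step: "(1 - fps_X ^ (2 * n + 2)) * u n *
          ((1 - fps_X ^ (2 * n + 1)) * (1 - fps_X ^ (2 * n + 2))) =
          (1 - fps_X ^ (2 * n + 2)) * (1 - fps_X ^ (2 * n + 2))" .
      have "R 0 (Suc n) = R 0 n * ((1 - fps_X ^ (2 * n + 2)) * u n)"
        by (simp add: R_def)
      moreover have A: "A (Suc n) = A n * (1 - fps_X ^ (2 * n + 2))"
        by (simp add: A_def)
      moreover have "(\<Prod>i<2 * Suc n. 1 - fps_X ^ (i + 1) :: real fps) =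
          (\<Prod>i<2*n. 1 - fps_X ^ (i + 1)) * ((1 - fps_X ^ (2 * n + 1)) * (1 - fps_X ^ (2 * n + 2)))"
      proof -
        have "2 * Suc n = Suc (Suc (2 * n))" "Suc (2 * n) + 1 = 2 * n + 2" by simp_all
        thus ?thesis by (simp only: prod.lessThan_Suc mult.assoc)
      qed
      ultimately have "R 0 (Suc n) * (\<Prod>i<2 * Suc n. 1 - fps_X ^ (i + 1)) =
          (R 0 n * (\<Prod>i<2*n. 1 - fps_X ^ (i + 1))) *
          ((1 - fps_X ^ (2 * n + 2)) * u n * ((1 - fps_X ^ (2 * n + 1)) * (1 - fps_X ^ (2 * n + 2))))"
        by (simp only: mult_ac)
      thus ?case
        unfolding Suc step A by (simp only: mult_ac)
    qed (simp add: R_def A_def)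
    have "P (2 * n) * (\<Prod>i<2*n. 1 - fps_X ^ (i + 1)) = 1"
      unfolding P_def by (rule bounded_partitions_gf)
    hence "R 0 n = R 0 n * (P (2 * n) * (\<Prod>i<2*n. 1 - fps_X ^ (i + 1)))"
      by (simp only: mult_1_right)
    also have "\<dots> = (R 0 n * (\<Prod>i<2*n. 1 - fps_X ^ (i + 1))) * P (2 * n)"
      by (simp only: mult_ac)
    finally show ?thesis
      unfolding RA .
  qed
  have "A \<longlonglongrightarrow> euler_fps 2"
    unfolding A_def by (rule euler_fps_LIMSEQ) simp
  moreover have "(\<lambda>n. P (2 * n)) \<longlonglongrightarrow> Abs_fps (\<lambda>n. real (partition_number n))"
    using LIMSEQ_subseq_LIMSEQ[OF bounded_partitions_gf_LIMSEQ, of "\<lambda>n. 2 * n"]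
    by (simp add: P_def o_def strict_mono_def)
  ultimately have "(R 0) \<longlonglongrightarrow> euler_fps 2 * euler_fps 2 * Abs_fps (\<lambda>n. real (partition_number n))"
    unfolding R0 by (intro tendsto_fps_mult)
  \<comment> \<open>Taking n \<ge> N + 1 pushes every term with s \<ge> 1 beyond degree N and
    ensures that s = 0 lies in the range s < n.\<close>
  moreover have coeff: "\<forall>\<^sub>F n in sequentially.
     fps_nth (\<Sum>k<2*n. fps_X ^ (k * (k + 1) div 2)) N = fps_nth (R 0 n) N" for N
    using eventually_ge_at_top[of "Suc N"]
  proof eventually_elim
    case (elim n)
    have "fps_nth (R s n * fps_X ^ (s * (2 * n + 1))) N = (if s = 0 then fps_nth (R 0 n) N else 0)" for s
    proof (cases "s = 0")
      case False
      have "N < 1 * (2 * n + 1)"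
        using elim by simp
      also have "\<dots> \<le> s * (2 * n + 1)"
        using False by (intro mult_le_mono1) simp
      finally have "N < s * (2 * n + 1)" .
      thus ?thesis
        using False by (simp only: fps_X_power_mult_right_nth if_True if_False)
    qed simp
    moreover have "(\<Sum>k<2*n. fps_X ^ (k * (k + 1) div 2)) = (\<Sum>s<n. R s n * fps_X ^ (s * (2 * n + 1)))"
      using shanks_identity[of u, OF u] unfolding R_def .
    ultimately have "fps_nth (\<Sum>k<2*n. fps_X ^ (k * (k + 1) div 2)) N =
        (\<Sum>s<n. if s = 0 then fps_nth (R 0 n) N else 0)"
      by (simp only: fps_sum_nth)
    thus ?case
      using elim by (simp only: sum.delta' sum.delta finite_lessThan) simp
  qed
  ultimately show ?thesis
    unfolding tendsto_fps_iff power2_eq_square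
  proof (intro allI)
    fix N
    assume "\<forall>N. \<forall>\<^sub>F n in sequentially. fps_nth (R 0 n) N =
      fps_nth (euler_fps 2 * euler_fps 2 * Abs_fps (\<lambda>n. real (partition_number n))) N"
    hence "\<forall>\<^sub>F n in sequentially. fps_nth (R 0 n) N =
      fps_nth (euler_fps 2 * euler_fps 2 * Abs_fps (\<lambda>n. real (partition_number n))) N" ..
    thus "\<forall>\<^sub>F n in sequentially. fps_nth (\<Sum>k<2*n. fps_X ^ (k * (k + 1) div 2)) N =
      fps_nth (euler_fps 2 * euler_fps 2 * Abs_fps (\<lambda>n. real (partition_number n))) N"
      using coeff[of N] by eventually_elim (simp only:)
  qed
qed

section \<open>Even-indexed coefficients and the summation bound\<close>

text \<open>Completing the square turns k(k + 1) \<le> 2n into (2k + 1)^2 \<le> 1 + 8n. Thus the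
  bound of the sum selects exactly the triangular numbers that can contribute to coefficient
  n.\<close>

lemma triangular_le_iff:
  "k \<le> nat \<lfloor>(sqrt (1 + 8 * real n) - 1) / 2\<rfloor> \<longleftrightarrow> k * (k + 1) div 2 \<le> n"
proof -
  have "k \<le> nat \<lfloor>(sqrt (1 + 8 * real n) - 1) / 2\<rfloor> \<longleftrightarrow> real k \<le> (sqrt (1 + 8 * real n) - 1) / 2"
    by (simp add: le_nat_iff le_floor_iff)
  also have "\<dots> \<longleftrightarrow> 2 * real k + 1 \<le> sqrt (1 + 8 * real n)"
    by (simp add: field_simps)
  also have "\<dots> \<longleftrightarrow> (2 * real k + 1)\<^sup>2 \<le> 1 + 8 * real n"
    by (metis abs_of_nonneg add_nonneg_nonneg mult_nonneg_nonneg of_nat_0_le_iff real_sqrt_abs real_sqrt_le_iff zero_le_numeral zero_le_one)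
  also have "(2 * real k + 1)\<^sup>2 = 1 + 4 * real (k * (k + 1))"
    by (simp add: power2_eq_square algebra_simps)
  also have "1 + 4 * real (k * (k + 1)) \<le> 1 + 8 * real n \<longleftrightarrow> real (k * (k + 1)) \<le> real (2 * n)"
    by linarith
  also have "\<dots> \<longleftrightarrow> k * (k + 1) \<le> 2 * n"
    by (rule of_nat_le_iff)
  also have "\<dots> \<longleftrightarrow> k * (k + 1) div 2 \<le> n"
  proof -
    have "2 * (k * (k + 1) div 2) = k * (k + 1)" by simp
    thus ?thesis by linarith
  qed
  finally show ?thesis .
qed

theorem theorem3p5:
  fixes n :: nat
  shows "EO_u (2 * n) =
    (\<Sum>k = 0..nat \<lfloor>(sqrt (1 + 8 * real n) - 1) / 2\<rfloor>. int (partition_number (n - k * (k + 1) div 2)))"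
proof -
  let ?K = "nat \<lfloor>(sqrt (1 + 8 * real n) - 1) / 2\<rfloor>"
  define P where "P = Abs_fps (\<lambda>n. real (partition_number n))"
  \<comment> \<open>Substituting q^2 for q in P = 1/f_1 makes \<open>p\<close> the inverse of
    f_2.\<close>
  define p where "p = P oo fps_X ^ 2"
  have "p * (euler_fps 1 oo fps_X ^ 2) = 1"
    unfolding p_def P_def
    by (subst fps_compose_mult_distrib[symmetric]) (simp_all only: partition_number_gf, simp_all)
  hence p: "p * euler_fps 2 = 1"
    using euler_fps_compose[of 1 2] by simp
  have "(euler_fps 4)\<^sup>2 / (euler_fps 2)\<^sup>2 = (euler_fps 4)\<^sup>2 * p\<^sup>2"
  proof -
    have "(euler_fps 4)\<^sup>2 = (euler_fps 4)\<^sup>2 * p\<^sup>2 * (euler_fps 2)\<^sup>2"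
      using p by (metis mult.assoc mult_1_right power_mult_distrib power_one)
    moreover have "(euler_fps 2)\<^sup>2 \<noteq> 0"
      using p by auto
    ultimately show ?thesis
      by (metis nonzero_mult_div_cancel_right)
  qed
  \<comment> \<open>Both factors are series in q^2, so coefficient 2n becomes coefficient n of f_2^2
    P^2, which is Gauss's series f_2^2 P times the partition series P.\<close>
  also have "\<dots> = ((euler_fps 2)\<^sup>2 * P\<^sup>2) oo fps_X ^ 2"
    using euler_fps_compose[of 2 2]
    by (simp add: p_def fps_compose_mult_distrib flip: fps_compose_power)
  finally have "real_of_int (EO_u (2 * n)) = fps_nth ((euler_fps 2)\<^sup>2 * P * P) n"
    unfolding of_int_EO_u by (simp only: fps_compose_X_power_nth zero_less_numeral power2_eq_square[of P] mult.assoc)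
  moreover have "(\<lambda>m. (\<Sum>k<2*m. fps_X ^ (k * (k + 1) div 2)) * P) \<longlonglongrightarrow> (euler_fps 2)\<^sup>2 * P * P"
    unfolding P_def by (intro tendsto_fps_mult gauss_triangular_LIMSEQ tendsto_const)
  hence "\<forall>\<^sub>F m in sequentially. ?K < m \<and>
      fps_nth ((\<Sum>k<2*m. fps_X ^ (k * (k + 1) div 2)) * P) n = fps_nth ((euler_fps 2)\<^sup>2 * P * P) n"
    unfolding tendsto_fps_iff by (intro eventually_conj eventually_gt_at_top) blast
  \<comment> \<open>Coefficient n has stabilised at this \<open>m\<close>, and \<open>?K < m\<close>
    makes the range k < 2m contain every k \<le> \<open>?K\<close>.\<close>
  then obtain m where m: "?K < m"
      "fps_nth ((\<Sum>k<2*m. fps_X ^ (k * (k + 1) div 2)) * P) n = fps_nth ((euler_fps 2)\<^sup>2 * P * P) n"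
    using eventually_happens'[OF sequentially_bot] by blast
  \<comment> \<open>Multiplying P by q^t shifts it, so coefficient n is p(n - t) for t \<le> n and 0
    otherwise; for t = k(k + 1)/2 the first case is k \<le> \<open>?K\<close>.\<close>
  moreover have "fps_nth ((\<Sum>k<2*m. fps_X ^ (k * (k + 1) div 2)) * P) n =
      (\<Sum>k<2*m. if k \<le> ?K then real (partition_number (n - k * (k + 1) div 2)) else 0)"
    unfolding sum_distrib_right fps_sum_nth fps_X_power_mult_nth triangular_le_iff
    by (intro sum.cong) (auto simp: P_def)
  moreover have "\<dots> = (\<Sum>k=0..?K. real (partition_number (n - k * (k + 1) div 2)))"
    using m(1) by (intro sum.mono_neutral_cong_right) auto
  ultimately have "real_of_int (EO_u (2 * n)) =
      real_of_int (\<Sum>k=0..?K. int (partition_number (n - k * (k + 1) div 2)))"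
    by simp
  thus ?thesis
    by (simp only: of_int_eq_iff)
qed

end
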